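(* Let $d\ge2$, $c\in k\setminus\{0\}$, $Q(X,S)\in k[X,S]$ and $P(X,S)=S^d+XQ(X,S)+c$. For $n\ge1$ let $B_{n,P}=k[X,S,Y]/\langle X^nY-P(X,S)\rangle$. Then $$B_{n,P}\otimes_kk[T]\simeq B_{m,P}\otimes_kk[T]$$ for all $n,m\ge1$. In addition, suppose $n<m$ and, for $n\le i<m$, let $\Phi_{i,i+1}$ be the explicit endomorphism of $k^{[4]}=k[X,S,Y,T]$ constructed in the context, which induces an isomorphism between $B_{i,P}[T]$ and $B_{i+1,P}[T]$. Then the endomorphism $\Phi_{m-1,m}\circ\cdots\circ\Phi_{n,n+1}$ of $k^{[4]}$ induces an isomorphism between $B_{n,P}[T]$ and $B_{m,P}[T]$.
   Context: $k$ is a field of characteristic zero; isomorphisms are of $k$-algebras, and $B_{n,P}[T]=B_{n,P}\otimes_kk[T]=k[X,S,Y,T]/\langle G_n\rangle$ with $G_n=X^nY-P(X,S)$. An endomorphism $\Phi$ of $k^{[4]}$ induces an isomorphism between $B_{i,P}[T]$ and $B_{j,P}[T]$ if $\Phi(G_i)\in\langle G_j\rangle$ and the induced homomorphism $k^{[4]}/\langle G_i\rangle\to k^{[4]}/\langle G_j\rangle$ is an isomorphism. Construction of $\Phi=\Phi_{i,i+1}$ (for $i\ge1$). Put $\Phi(X)=X$, $\Phi(S)=S+H$, $\Phi(Y)=XY+L$, where $H=X^iT$, and where $L\in k[X,S,T]$ and $\Phi(T)\in k[X,S,Y,T]$ are determined by the requirements (a) $\Phi(X^iY-P(X,S))=X^{i+1}Y-P(X,S)$,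 i.e. $X^iL=P(X,S+H)-P(X,S)$; (b) $\Phi(YS-XT)=dT\bigl(-X^{i+1}Y+P(X,S)-c\bigr)$, which is congruent to $-dcT$ modulo $\langle X^{i+1}Y-P(X,S)\rangle$; this can be solved for $\Phi(T)$ because $X$ divides every coefficient of $P(X,S)-S^d-c$ as a polynomial in $S$. For example, for $i=1$ and $P=S^4+X^2S^2+1$: $H=XT$, $\Phi(Y)=XY+X^3T^4+4X^2T^3S+6XT^2S^2+4TS^3+T^2X^3+2TSX^2$, and $\Phi(T)$ is determined by $\Phi(YS-XT)=4T(-X^2Y+S^4+X^2S^2)$. *)

theory Defs
  imports "HOL-Algebra.Algebraic_Closure_Type" "HOL-Algebra.UnivPoly"
begin

text \<open>
  The rings \<open>k[X,S]\<close>, \<open>k[X,S,Y]\<close> and \<open>k[X,S,Y,T]\<close> are iterated univariate polynomial rings, with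
  \<open>X\<close> the innermost and the last variable the outermost one. The inclusion of each of them into
  the next is therefore \<open>p \<mapsto> [:p:]\<close>.
\<close>

type_synonym 'k pol2 = "'k poly poly"
type_synonym 'k pol3 = "'k poly poly poly"
type_synonym 'k pol4 = "'k poly poly poly poly"

definition const2 :: "'k::field \<Rightarrow> 'k pol2" where "const2 a = [:[:a:]:]"
definition X2 :: "'k::field pol2" where "X2 = [:[:0, 1:]:]"
definition S2 :: "'k::field pol2" where "S2 = [:0, 1:]"

definition const3 :: "'k::field \<Rightarrow> 'k pol3" where "const3 a = [:const2 a:]"
definition X3 :: "'k::field pol3" where "X3 = [:X2:]"
definition Y3 :: "'k::field pol3" where "Y3 = [:0, 1:]"

definition const4 :: "'k::field \<Rightarrow> 'k pol4" where "const4 a = [:const3 a:]"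
definition X4 :: "'k::field pol4" where "X4 = [:X3:]"
definition S4 :: "'k::field pol4" where "S4 = [:[:S2:]:]"
definition Y4 :: "'k::field pol4" where "Y4 = [:Y3:]"
definition T4 :: "'k::field pol4" where "T4 = [:0, 1:]"

text \<open>
  The subring \<open>k[X,S,T]\<close> of \<open>k[X,S,Y,T]\<close>: every coefficient, as a polynomial in \<open>T\<close>, is constant
  in \<open>Y\<close>.
\<close>
definition subring_XST :: "'k::field pol4 set" where
  "subring_XST = {p. \<forall>j. \<exists>q :: 'k pol2. poly.coeff p j = [:q:]}"

definition P_poly :: "nat \<Rightarrow> 'k::field \<Rightarrow> 'k pol2 \<Rightarrow> 'k pol2" where
  "P_poly d c Q = S2 ^ d + X2 * Q + const2 c"

definition G3 :: "'k::field pol2 \<Rightarrow> nat \<Rightarrow> 'k pol3" where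
  "G3 P n = X3 ^ n * Y3 - [:P:]"

definition G4 :: "'k::field pol2 \<Rightarrow> nat \<Rightarrow> 'k pol4" where
  "G4 P n = X4 ^ n * Y4 - [:[:P:]:]"

text \<open>
  A \<open>k\<close>-algebra is a ring \<open>R\<close> together with its structure map \<open>\<iota> : k \<rightarrow> R\<close>, so that a homomorphism
  of \<open>k\<close>-algebras is a ring homomorphism compatible with the structure maps.
\<close>

definition alg_hom ::
  "('a, 'm) ring_scheme \<Rightarrow> ('k \<Rightarrow> 'a) \<Rightarrow> ('b, 'n) ring_scheme \<Rightarrow> ('k \<Rightarrow> 'b) \<Rightarrow> ('a \<Rightarrow> 'b) set" where
  "alg_hom R \<iota> S \<kappa> = {h \<in> ring_hom R S. \<forall>a. h (\<iota> a) = \<kappa> a}"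

definition alg_iso ::
  "('a, 'm) ring_scheme \<Rightarrow> ('k \<Rightarrow> 'a) \<Rightarrow> ('b, 'n) ring_scheme \<Rightarrow> ('k \<Rightarrow> 'b) \<Rightarrow> ('a \<Rightarrow> 'b) set" where
  "alg_iso R \<iota> S \<kappa> = {h \<in> ring_iso R S. \<forall>a. h (\<iota> a) = \<kappa> a}"

definition alg_isomorphic ::
  "('a, 'm) ring_scheme \<Rightarrow> ('k \<Rightarrow> 'a) \<Rightarrow> ('b, 'n) ring_scheme \<Rightarrow> ('k \<Rightarrow> 'b) \<Rightarrow> bool" where
  "alg_isomorphic R \<iota> S \<kappa> \<longleftrightarrow> alg_iso R \<iota> S \<kappa> \<noteq> {}"

abbreviation k3 :: "'k::field pol3 ring" where "k3 \<equiv> ring_of_type_algebra"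
abbreviation k4 :: "'k::field pol4 ring" where "k4 \<equiv> ring_of_type_algebra"

definition B_ideal :: "'k::field pol2 \<Rightarrow> nat \<Rightarrow> 'k pol3 set" where
  "B_ideal P n = PIdl\<^bsub>k3\<^esub> (G3 P n)"

definition B :: "'k::field pol2 \<Rightarrow> nat \<Rightarrow> 'k pol3 set ring" where
  "B P n = k3 Quot (B_ideal P n)"

definition B_const :: "'k::field pol2 \<Rightarrow> nat \<Rightarrow> 'k \<Rightarrow> 'k pol3 set" where
  "B_const P n a = B_ideal P n +>\<^bsub>k3\<^esub> const3 a"

text \<open>
  The algebra \<open>B[T]\<close>, that is \<open>B\<close> tensored over \<open>k\<close> with \<open>k[T]\<close>, occurs in two forms: as the
  polynomial ring in one variable over \<open>B\<close>, and as the quotient of \<open>k[X,S,Y,T]\<close> by the ideal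
  generated by the same relation.
\<close>

definition BT :: "'k::field pol2 \<Rightarrow> nat \<Rightarrow> ('k pol3 set, nat \<Rightarrow> 'k pol3 set) up_ring" where
  "BT P n = UP (B P n)"

definition BT_const :: "'k::field pol2 \<Rightarrow> nat \<Rightarrow> 'k \<Rightarrow> nat \<Rightarrow> 'k pol3 set" where
  "BT_const P n a = up_ring.monom (BT P n) (B_const P n a) 0"

definition BT4_ideal :: "'k::field pol2 \<Rightarrow> nat \<Rightarrow> 'k pol4 set" where
  "BT4_ideal P n = PIdl\<^bsub>k4\<^esub> (G4 P n)"

definition BT4 :: "'k::field pol2 \<Rightarrow> nat \<Rightarrow> 'k pol4 set ring" where
  "BT4 P n = k4 Quot (BT4_ideal P n)"

definition BT4_const :: "'k::field pol2 \<Rightarrow> nat \<Rightarrow> 'k \<Rightarrow> 'k pol4 set" where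
  "BT4_const P n a = BT4_ideal P n +>\<^bsub>k4\<^esub> const4 a"

definition alg_endo :: "('k::field pol4 \<Rightarrow> 'k pol4) \<Rightarrow> bool" where
  "alg_endo \<Phi> \<longleftrightarrow> \<Phi> \<in> alg_hom k4 const4 k4 const4"

definition induces_iso ::
  "'k::field pol2 \<Rightarrow> nat \<Rightarrow> nat \<Rightarrow> ('k pol4 \<Rightarrow> 'k pol4) \<Rightarrow> bool" where
  "induces_iso P i j \<Phi> \<longleftrightarrow>
     alg_endo \<Phi> \<and> \<Phi> (G4 P i) \<in> BT4_ideal P j \<and>
     (\<exists>h \<in> alg_iso (BT4 P i) (BT4_const P i) (BT4 P j) (BT4_const P j).
        \<forall>p. h (BT4_ideal P i +>\<^bsub>k4\<^esub> p) = BT4_ideal P j +>\<^bsub>k4\<^esub> \<Phi> p)"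

text \<open>
  The requirements that determine \<open>\<Phi>\<^sub>i\<^sub>,\<^sub>i\<^sub>+\<^sub>1\<close>. Since \<open>\<Phi>\<close> is an endomorphism with \<open>\<Phi>(X) = X\<close> and
  \<open>\<Phi>(S) = S + H\<close>, where \<open>H = X\<^sup>i T\<close>, the element \<open>P(X, S + H)\<close> is \<open>\<Phi>(P)\<close>; thus the equation
  for \<open>L\<close> reads \<open>X\<^sup>i L = P(X, S + H) - P(X, S)\<close>.
\<close>
definition is_Phi ::
  "nat \<Rightarrow> 'k::field \<Rightarrow> 'k pol2 \<Rightarrow> nat \<Rightarrow> ('k pol4 \<Rightarrow> 'k pol4) \<Rightarrow> bool" where
  "is_Phi d c P i \<Phi> \<longleftrightarrow>
     alg_endo \<Phi> \<and>
     \<Phi> X4 = X4 \<and>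
     \<Phi> S4 = S4 + X4 ^ i * T4 \<and>
     (\<exists>L \<in> subring_XST. \<Phi> Y4 = X4 * Y4 + L \<and> X4 ^ i * L = \<Phi> [:[:P:]:] - [:[:P:]:]) \<and>
     \<Phi> (G4 P i) = G4 P (i + 1) \<and>
     \<Phi> (Y4 * S4 - X4 * T4) = of_nat d * T4 * (- (X4 ^ (i + 1)) * Y4 + [:[:P:]:] - const4 c)"

end

theory Submission
  imports Defs
begin

text \<open>
  Write \<open>G\<^sub>n = X\<^sup>n Y - P\<close> and \<open>H = X\<^sup>i T\<close>. Taylor expansion of \<open>P\<close> in \<open>S\<close> gives
  \<open>P(X, S + H) - P(X, S) = X\<^sup>i L\<close> with \<open>L \<in> k[X,S,T]\<close> and, since \<open>P\<close> is \<open>S\<^sup>d + c\<close> modulo \<open>X\<close> and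
  \<open>i \<ge> 1\<close>, with \<open>L \<equiv> d T S\<^sup>d\<^sup>-\<^sup>1\<close> modulo \<open>X\<close> (lemma \<open>increment_quotient\<close>). Modulo \<open>X\<close> the prescribed
  value of \<open>X \<Phi>(T)\<close> is therefore \<open>L S - d T (P - c) \<equiv> d T S\<^sup>d - d T S\<^sup>d = 0\<close>, so \<open>\<Phi>(T)\<close> exists; it is
  unique because \<open>k[X,S,Y,T]\<close> is a domain, and so \<open>\<Phi>\<^sub>i\<^sub>,\<^sub>i\<^sub>+\<^sub>1\<close> exists and is unique (lemma \<open>ex1_Phi\<close>).

  That \<open>\<Phi>\<close> induces an isomorphism is shown by an explicit inverse \<open>\<Psi>\<close> up to multiples of the
  relations (lemma \<open>Phi_inverse_mod\<close>). Requirement (b) makes \<open>\<Phi>(Y S - X T)\<close> congruent to \<open>- d c T\<close>, which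
  forces \<open>\<Psi>(T) = t = - (Y S - X T) / (d c)\<close>, and then \<open>\<Psi>(S) = s = S - X\<^sup>i t\<close>. The value
  \<open>y = \<Psi>(Y)\<close> has to satisfy \<open>X y \<equiv> Y - L(X, s, t)\<close> modulo \<open>G\<^sub>i\<close>. Modulo \<open>X\<close> the right-hand side is
  \<open>Y - d t S\<^sup>d\<^sup>-\<^sup>1 \<equiv> Y (c + S\<^sup>d) / c \<equiv> Y P / c \<equiv> - Y G\<^sub>i / c\<close>, a multiple of \<open>G\<^sub>i\<close>, so such a \<open>y\<close> exists.
  The congruences for \<open>\<Psi>(\<Phi>(T))\<close> and \<open>\<Phi>(\<Psi>(Y))\<close> hold after multiplication by \<open>X\<close>, and \<open>X\<close> can be cancelled
  modulo \<open>G\<^sub>i\<close> because \<open>X\<close> is prime and does not divide \<open>G\<^sub>i\<close>, whose constant term is \<open>- c\<close>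
  (lemma \<open>X_cancel_mod_G\<close>).

  Bijectivity modulo the relations is preserved by composition, which settles the composite
  \<open>\<Phi>\<^sub>m\<^sub>-\<^sub>1\<^sub>,\<^sub>m \<circ> \<dots> \<circ> \<Phi>\<^sub>n\<^sub>,\<^sub>n\<^sub>+\<^sub>1\<close>. The statement about tensor products follows because taking residues of
  coefficients identifies \<open>k[X,S,Y,T] / (G\<^sub>n)\<close> with polynomials in \<open>T\<close> over \<open>k[X,S,Y] / (G\<^sub>n)\<close>
  (lemma \<open>BT4_isomorphic_BT\<close>).

  Congruence of \<open>a\<close> and \<open>b\<close> modulo a principal ideal is written \<open>m dvd a - b\<close> throughout; for
  \<open>m = 0\<close> it is equality, so that one lemma serves for both.
\<close>

section \<open>Homomorphisms of commutative rings and congruences\<close>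

locale unital_ring_hom =
  fixes h :: "'a::comm_ring_1 \<Rightarrow> 'b::comm_ring_1"
  assumes hom_one [simp]: "h 1 = 1"
    and hom_add [simp]: "h (x + y) = h x + h y"
    and hom_mult [simp]: "h (x * y) = h x * h y"
begin

lemma hom_zero [simp]: "h 0 = 0"
  using hom_add[of 0 0] by simp

lemma hom_uminus [simp]: "h (- x) = - h x"
  using hom_add[of x "- x"] by (simp add: eq_neg_iff_add_eq_0 add.commute)

lemma hom_diff [simp]: "h (x - y) = h x - h y"
  using hom_add[of x "- y"] by simp

lemma hom_power [simp]: "h (x ^ n) = h x ^ n"
  by (induction n) simp_all

lemma hom_of_nat [simp]: "h (of_nat n) = of_nat n"
  by (induction n) simp_all

lemma hom_dvd: "x dvd y \<Longrightarrow> h x dvd h y"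
  by (auto elim!: dvdE)

end

text \<open>
  Restricting to constant polynomials peels off one variable, which reduces statements about the
  iterated polynomial ring to four applications of a statement about one variable.
\<close>
lemma unital_ring_hom_const_poly:
  fixes h :: "'a::comm_ring_1 poly \<Rightarrow> 'b::comm_ring_1"
  assumes "unital_ring_hom h"
  shows "unital_ring_hom (\<lambda>a. h [:a:])"
proof -
  interpret unital_ring_hom h by fact
  have "h [:a + b:] = h [:a:] + h [:b:]" "h [:a * b:] = h [:a:] * h [:b:]" for a b
    using hom_add[of "[:a:]" "[:b:]"] hom_mult[of "[:a:]" "[:b:]"] by (simp_all add: mult.commute)
  then show ?thesis by unfold_locales (simp_all flip: one_pCons)
qed

definition eval_hom :: "('a::comm_ring_1 \<Rightarrow> 'b::comm_ring_1) \<Rightarrow> 'b \<Rightarrow> 'a poly \<Rightarrow> 'b"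
  where "eval_hom h b p = poly (map_poly h p) b"

context unital_ring_hom
begin

lemma eval_hom_pCons: "eval_hom h b (pCons a p) = h a + b * eval_hom h b p"
  by (simp add: eval_hom_def map_poly_pCons)

lemma eval_hom_0: "eval_hom h b 0 = 0"
  by (simp add: eval_hom_def)

lemma eval_hom_const [simp]: "eval_hom h b [:a:] = h a"
  by (simp add: eval_hom_pCons eval_hom_0)

lemma eval_hom_var [simp]: "eval_hom h b [:0, 1:] = b"
  by (simp add: eval_hom_pCons eval_hom_0)

lemma eval_hom_add: "eval_hom h b (p + q) = eval_hom h b p + eval_hom h b q"
  by (induction p q rule: poly_induct2) (simp_all add: eval_hom_pCons eval_hom_0 algebra_simps)

lemma eval_hom_smult: "eval_hom h b (smult a p) = h a * eval_hom h b p"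
  by (induction p) (simp_all add: eval_hom_pCons eval_hom_0 algebra_simps)

lemma eval_hom_mult: "eval_hom h b (p * q) = eval_hom h b p * eval_hom h b q"
  by (induction p)
    (simp_all add: eval_hom_pCons eval_hom_0 eval_hom_add eval_hom_smult algebra_simps)

lemma eval_hom_is_hom: "unital_ring_hom (eval_hom h b)"
  by unfold_locales (simp_all add: eval_hom_add eval_hom_mult one_pCons)

end

lemma dvd_diff_mult:
  fixes a b c e m :: "'a::comm_ring_1"
  assumes "m dvd a - b" "m dvd c - e"
  shows "m dvd a * c - b * e"
proof -
  have "a * c - b * e = a * (c - e) + (a - b) * e" by (simp add: algebra_simps)
  then show ?thesis using assms by simp
qed

lemma dvd_diff_add:
  fixes a b c e m :: "'a::comm_ring_1"
  assumes "m dvd a - b" "m dvd c - e"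
  shows "m dvd (a + c) - (b + e)"
  using dvd_add[OF assms] by (simp add: algebra_simps)

lemma dvd_diff_power:
  fixes a b m :: "'a::comm_ring_1"
  assumes "m dvd a - b"
  shows "m dvd a ^ n - b ^ n"
  by (induction n) (simp_all add: dvd_diff_mult assms)

lemma dvd_diff_trans:
  fixes a b c m :: "'a::comm_ring_1"
  assumes "m dvd a - b" "m dvd b - c"
  shows "m dvd a - c"
  using dvd_add[OF assms] by simp

lemma dvd_diffD:
  fixes a b m :: "'a::comm_ring_1"
  assumes "m dvd a - b"
  shows "\<exists>r. a = b + m * r"
  using assms by (auto simp: dvd_def diff_eq_eq add.commute)

text \<open>
  The coefficient hypothesis speaks only of the coefficients of \<open>p\<close>, not of the whole coefficient
  ring; this is what makes the lemma applicable to elements of a subring like \<open>k[X,S,T]\<close>.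
\<close>
lemma poly_homs_agree_mod:
  fixes f g :: "'a::comm_ring_1 poly \<Rightarrow> 'b::comm_ring_1"
  assumes "unital_ring_hom f" "unital_ring_hom g"
    and "m dvd f [:0, 1:] - g [:0, 1:]"
    and "\<And>j. m dvd f [:poly.coeff p j:] - g [:poly.coeff p j:]"
  shows "m dvd f p - g p"
  using assms(4)
proof (induction p)
  case 0
  interpret f: unital_ring_hom f by fact
  interpret g: unital_ring_hom g by fact
  show ?case by simp
next
  case (pCons a p)
  interpret f: unital_ring_hom f by fact
  interpret g: unital_ring_hom g by fact
  have split: "pCons a p = [:a:] + [:0, 1:] * p" by simp
  have "m dvd f [:a:] - g [:a:]" using pCons.prems[of 0] by simp
  moreover have "m dvd f p - g p"
    using pCons.prems[of "Suc j" for j] by (intro pCons.IH) simp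
  ultimately show ?case
    unfolding split f.hom_add g.hom_add f.hom_mult g.hom_mult
    by (intro dvd_diff_add dvd_diff_mult assms(3))
qed

section \<open>Endomorphisms of k[X,S,Y,T]\<close>

lemma alg_endo_iff:
  "alg_endo \<Phi> \<longleftrightarrow> unital_ring_hom \<Phi> \<and> (\<forall>a. \<Phi> (const4 a) = const4 a)"
  by (auto simp: alg_endo_def alg_hom_def ring_hom_def unital_ring_hom_def ring_of_type_algebra_def)

abbreviation emb :: "'k::field pol2 \<Rightarrow> 'k pol4" where "emb p \<equiv> [:[:p:]:]"

lemma alg_endo_agree_mod_X:
  fixes f g :: "'k::field pol4 \<Rightarrow> 'k pol4"
  assumes "alg_endo f" "alg_endo g" and X: "m dvd f X4 - g X4"
  shows "m dvd f (emb [:a:]) - g (emb [:a:])"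
proof -
  note const = unital_ring_hom_const_poly
  have hom: "unital_ring_hom (\<lambda>a. h (emb [:a:]))" if "alg_endo h" for h :: "'k pol4 \<Rightarrow> 'k pol4"
    using that by (intro const[OF const[OF const]]) (simp add: alg_endo_iff)
  show ?thesis
    by (rule poly_homs_agree_mod[OF hom[OF assms(1)] hom[OF assms(2)]])
      (use assms in \<open>simp_all add: X4_def X3_def X2_def alg_endo_iff const4_def const3_def const2_def\<close>)
qed

lemma alg_endo_agree_mod_XS:
  fixes f g :: "'k::field pol4 \<Rightarrow> 'k pol4"
  assumes "alg_endo f" "alg_endo g" "m dvd f X4 - g X4" and S: "m dvd f S4 - g S4"
  shows "m dvd f (emb p) - g (emb p)"
proof -
  have hom: "unital_ring_hom (\<lambda>a. h (emb a))" if "alg_endo h" for h :: "'k pol4 \<Rightarrow> 'k pol4"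
    using that by (intro unital_ring_hom_const_poly[OF unital_ring_hom_const_poly])
      (simp add: alg_endo_iff)
  show ?thesis
    by (rule poly_homs_agree_mod[OF hom[OF assms(1)] hom[OF assms(2)]])
      (use assms S in \<open>simp_all add: alg_endo_agree_mod_X S4_def S2_def\<close>)
qed

lemma alg_endo_agree_mod_XST:
  fixes f g :: "'k::field pol4 \<Rightarrow> 'k pol4"
  assumes "alg_endo f" "alg_endo g" "m dvd f X4 - g X4" "m dvd f S4 - g S4"
    and T: "m dvd f T4 - g T4" and p: "p \<in> subring_XST"
  shows "m dvd f p - g p"
proof (rule poly_homs_agree_mod[where f = f and g = g])
  show "m dvd f [:poly.coeff p j:] - g [:poly.coeff p j:]" for j
  proof -
    obtain q where "poly.coeff p j = [:q:]" using p by (auto simp: subring_XST_def)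
    then show ?thesis using alg_endo_agree_mod_XS[OF assms(1-4)] by simp
  qed
qed (use assms in \<open>simp_all add: alg_endo_iff T4_def\<close>)

lemma alg_endo_agree_mod:
  fixes f g :: "'k::field pol4 \<Rightarrow> 'k pol4"
  assumes "alg_endo f" "alg_endo g" "m dvd f X4 - g X4" "m dvd f S4 - g S4"
    and Y: "m dvd f Y4 - g Y4" and T: "m dvd f T4 - g T4"
  shows "m dvd f p - g p"
proof (rule poly_homs_agree_mod[where f = f and g = g])
  have hom: "unital_ring_hom (\<lambda>a. h [:a:])" if "alg_endo h" for h :: "'k pol4 \<Rightarrow> 'k pol4"
    using that by (intro unital_ring_hom_const_poly) (simp add: alg_endo_iff)
  show "m dvd f [:poly.coeff p j:] - g [:poly.coeff p j:]" for j
    by (rule poly_homs_agree_mod[OF hom[OF assms(1)] hom[OF assms(2)]])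
      (use assms alg_endo_agree_mod_XS[OF assms(1-4)] in \<open>simp_all add: Y4_def Y3_def\<close>)
qed (use assms in \<open>simp_all add: alg_endo_iff T4_def\<close>)

text \<open>
  The evaluations are nested from the innermost variable \<open>X\<close> to the outermost variable \<open>T\<close>, with the
  inclusion of \<open>k\<close> at the bottom.
\<close>
definition subst4 ::
  "'k::field pol4 \<Rightarrow> 'k pol4 \<Rightarrow> 'k pol4 \<Rightarrow> 'k pol4 \<Rightarrow> 'k pol4 \<Rightarrow> 'k pol4"
  where "subst4 x s y t = eval_hom (eval_hom (eval_hom (eval_hom const4 x) s) y) t"

lemma subst4:
  fixes x s y t :: "'k::field pol4"
  shows alg_endo_subst4: "alg_endo (subst4 x s y t)"
    and subst4_X [simp]: "subst4 x s y t X4 = x"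
    and subst4_S [simp]: "subst4 x s y t S4 = s"
    and subst4_Y [simp]: "subst4 x s y t Y4 = y"
    and subst4_T [simp]: "subst4 x s y t T4 = t"
proof -
  have c: "unital_ring_hom (const4 :: 'k \<Rightarrow> _)"
    by unfold_locales (simp_all add: const4_def const3_def const2_def one_pCons)
  note c1 = unital_ring_hom.eval_hom_is_hom[OF c, of x]
  note c2 = unital_ring_hom.eval_hom_is_hom[OF c1, of s]
  note c3 = unital_ring_hom.eval_hom_is_hom[OF c2, of y]
  note c4 = unital_ring_hom.eval_hom_is_hom[OF c3, of t]
  note [simp] = unital_ring_hom.eval_hom_const[OF c] unital_ring_hom.eval_hom_const[OF c1]
    unital_ring_hom.eval_hom_const[OF c2] unital_ring_hom.eval_hom_const[OF c3]
    unital_ring_hom.eval_hom_var[OF c] unital_ring_hom.eval_hom_var[OF c1]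
    unital_ring_hom.eval_hom_var[OF c2] unital_ring_hom.eval_hom_var[OF c3]
  show "alg_endo (subst4 x s y t)"
    using c4 by (simp add: alg_endo_iff subst4_def)
      (simp add: const4_def const3_def const2_def)
  show "subst4 x s y t X4 = x" "subst4 x s y t S4 = s" "subst4 x s y t Y4 = y"
    "subst4 x s y t T4 = t"
    by (simp_all add: subst4_def X4_def X3_def X2_def S4_def S2_def Y4_def Y3_def T4_def)
qed

section \<open>Taylor expansion inside k[X,S,T]\<close>

lemma XST_add:
  fixes p q :: "'k::field pol4"
  assumes "p \<in> subring_XST" "q \<in> subring_XST"
  shows "p + q \<in> subring_XST"
proof -
  have "\<exists>r. poly.coeff p j + poly.coeff q j = [:r:]" for j
  proof -
    obtain a b where "poly.coeff p j = [:a:]" "poly.coeff q j = [:b:]"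
      using assms unfolding subring_XST_def by blast
    then show ?thesis by (intro exI[of _ "a + b"]) simp
  qed
  then show ?thesis by (simp add: subring_XST_def)
qed

lemma XST_mult:
  fixes p q :: "'k::field pol4"
  assumes "p \<in> subring_XST" "q \<in> subring_XST"
  shows "p * q \<in> subring_XST"
proof -
  have sum_const: "\<exists>r. sum f A = [:r:]"
    if "\<And>i. i \<in> A \<Longrightarrow> \<exists>r :: 'k pol2. f i = [:r:]" for f and A :: "nat set"
    using that
  proof (induction A rule: infinite_finite_induct)
    case (insert x A)
    then obtain r r' where "f x = [:r:]" "sum f A = [:r':]" by (metis insertCI)
    then show ?case using insert.hyps by (intro exI[of _ "r + r'"]) simp
  qed (auto intro: exI[of _ 0])
  have "\<exists>r. poly.coeff p i * poly.coeff q j = [:r:]" for i j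
  proof -
    obtain a b where "poly.coeff p i = [:a:]" "poly.coeff q j = [:b:]"
      using assms unfolding subring_XST_def by blast
    then show ?thesis by (intro exI[of _ "a * b"]) simp
  qed
  then show ?thesis by (simp add: subring_XST_def Polynomial.coeff_mult sum_const)
qed

lemma XST_emb [simp]: "emb p \<in> subring_XST"
proof -
  have "\<exists>q. poly.coeff (emb p) j = [:q:]" for j
    by (cases j) (auto intro: exI[of _ 0])
  then show ?thesis by (simp add: subring_XST_def)
qed

lemma XST_X [simp]: "X4 \<in> subring_XST" and XST_S [simp]: "S4 \<in> subring_XST"
  by (simp_all add: X4_def X3_def S4_def)

lemma XST_0 [simp]: "0 \<in> subring_XST"
  using XST_emb[of 0] by simp

lemma XST_1 [simp]: "1 \<in> subring_XST"
  using XST_emb[of 1] by (simp flip: one_pCons)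

lemma XST_T [simp]: "(T4 :: 'k::field pol4) \<in> subring_XST"
proof -
  have "\<exists>q. poly.coeff (T4 :: 'k pol4) j = [:q:]" for j
    by (auto simp: T4_def coeff_pCons one_pCons split: nat.splits intro: exI[of _ 0])
  then show ?thesis by (simp add: subring_XST_def)
qed

lemma XST_power: "p \<in> subring_XST \<Longrightarrow> p ^ n \<in> subring_XST"
  by (induction n) (simp_all add: XST_mult)

text \<open>
  Taylor's formula to first order, with \<open>\<Phi>(p)\<close> in the role of \<open>p(X, S + H)\<close>. That the remainder \<open>q\<close>
  is again in \<open>k[X,S,T]\<close> is needed because \<open>L\<close> is required to lie there.
\<close>
lemma Taylor_S:
  fixes p :: "'k::field pol2"
  assumes "alg_endo \<Phi>" "\<Phi> X4 = X4" "\<Phi> S4 = S4 + H" "H \<in> subring_XST"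
  shows "\<exists>q\<in>subring_XST. \<Phi> (emb p) = emb p + H * emb (pderiv p) + H\<^sup>2 * q"
proof (induction p)
  case 0
  interpret \<Phi>: unital_ring_hom \<Phi> using assms by (simp add: alg_endo_iff)
  show ?case by (intro bexI[of _ 0]) (simp_all add: \<Phi>.hom_zero pderiv_0)
next
  case (pCons a p)
  interpret \<Phi>: unital_ring_hom \<Phi> using assms by (simp add: alg_endo_iff)
  obtain q where q: "q \<in> subring_XST" "\<Phi> (emb p) = emb p + H * emb (pderiv p) + H\<^sup>2 * q"
    using pCons.IH by blast
  have const: "\<Phi> (emb [:a:]) = emb [:a:]"
    using alg_endo_agree_mod_X[OF assms(1) _, of id 0 a] assms(2)
    by (simp add: alg_endo_iff unital_ring_hom_def)
  have split: "emb (pCons a p) = emb [:a:] + S4 * emb p"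
    by (simp add: S4_def S2_def)
  have deriv: "emb (pderiv (pCons a p)) = emb p + S4 * emb (pderiv p)"
    by (simp add: S4_def S2_def pderiv_pCons)
  have expand: "A + (S4 + H) * (B + H * C + H\<^sup>2 * q)
      = A + S4 * B + H * (B + S4 * C) + H\<^sup>2 * (C + (S4 + H) * q)" for A B C
    by (simp add: algebra_simps power2_eq_square)
  have "\<Phi> (emb (pCons a p)) = emb (pCons a p) + H * emb (pderiv (pCons a p))
      + H\<^sup>2 * (emb (pderiv p) + (S4 + H) * q)"
    unfolding deriv split \<Phi>.hom_add \<Phi>.hom_mult const q assms(3)
    by (rule expand)
  then show ?case
    by (rule bexI) (use q assms(4) in \<open>auto intro!: XST_add XST_mult\<close>)
qed

section \<open>Existence and uniqueness of the endomorphisms\<close>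

lemma prime_elem_X4: "prime_elem (X4 :: 'k::field pol4)"
  unfolding X4_def X3_def X2_def
  by (intro lift_prime_elem_poly prime_elem_linear_field_poly) simp

lemma X4_nonzero [simp]: "(X4 :: 'k::field pol4) \<noteq> 0"
  by (simp add: X4_def X3_def X2_def)

lemma unital_ring_hom_emb: "unital_ring_hom (\<lambda>p :: 'k::field pol2. emb p)"
  by unfold_locales (simp_all add: one_pCons)

lemmas emb_distribs =
  unital_ring_hom.hom_add[OF unital_ring_hom_emb] unital_ring_hom.hom_mult[OF unital_ring_hom_emb]
  unital_ring_hom.hom_power[OF unital_ring_hom_emb] unital_ring_hom.hom_of_nat[OF unital_ring_hom_emb]

lemma alg_endo_comp: "alg_endo f \<Longrightarrow> alg_endo g \<Longrightarrow> alg_endo (\<lambda>p. f (g p))"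
  by (simp add: alg_endo_iff unital_ring_hom_def)

lemma alg_endo_id: "alg_endo (\<lambda>p. p)"
  by (simp add: alg_endo_iff unital_ring_hom_def)

locale Danielewski =
  fixes d :: nat and c :: "'k::field_char_0" and Q P :: "'k pol2"
  assumes d: "d \<ge> 2" and c: "c \<noteq> 0" and P: "P = P_poly d c Q"
begin

lemma emb_P: "emb P = S4 ^ d + X4 * emb Q + const4 c"
  unfolding P P_poly_def emb_distribs S4_def X4_def X3_def const4_def const3_def ..

lemma emb_pderiv_P: "emb (pderiv P) = of_nat d * S4 ^ (d - 1) + X4 * emb (pderiv Q)"
proof -
  have "pderiv (S2 ^ d) = (of_nat d * S2 ^ (d - 1) :: 'k pol2)"
    using d pderiv_power_Suc[of "S2 :: 'k pol2" "d - 1"]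
    by (simp add: S2_def pderiv_pCons of_nat_poly)
  moreover have "pderiv (X2 * Q) = X2 * pderiv Q" "pderiv (const2 c) = 0"
    by (simp_all add: X2_def const2_def pderiv_smult pderiv_pCons)
  ultimately have "pderiv P = of_nat d * S2 ^ (d - 1) + X2 * pderiv Q"
    by (simp add: P P_poly_def pderiv_add)
  then have "emb (pderiv P) = of_nat d * emb S2 ^ (d - 1) + emb X2 * emb (pderiv Q)"
    by (simp only: emb_distribs)
  then show ?thesis
    by (simp only: S4_def X4_def X3_def)
qed

text \<open>
  The constant term of \<open>G\<^sub>i\<close> is \<open>- c \<noteq> 0\<close>, whereas that of a multiple of \<open>X\<close> is \<open>0\<close>.
\<close>
lemma X_not_dvd_G: "i \<ge> 1 \<Longrightarrow> \<not> X4 dvd G4 P i"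
proof
  assume i: "i \<ge> 1" and "X4 dvd G4 P i"
  then obtain q where q: "G4 P i = X4 * q" by (auto elim: dvdE)
  define at0 :: "'k pol4 \<Rightarrow> 'k" where "at0 p = poly (poly (poly (poly p 0) 0) 0) 0" for p
  have "at0 (X4 * q) = 0" by (simp add: at0_def X4_def X3_def X2_def)
  moreover have "at0 (G4 P i) = - c"
    unfolding G4_def emb_P using i d
    by (simp add: at0_def X4_def X3_def X2_def S4_def S2_def const4_def const3_def const2_def power_0_left)
  ultimately show False using q c by simp
qed

text \<open>
  From \<open>X f = G\<^sub>i g\<close> it follows that the prime \<open>X\<close> divides \<open>g\<close>. In other words \<open>X\<close> is not a zero
  divisor modulo \<open>G\<^sub>i\<close>, which replaces passing to the localization \<open>k[X, 1/X, S, T]\<close>.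
\<close>
lemma X_cancel_mod_G:
  assumes "i \<ge> 1" "G4 P i dvd X4 * f"
  shows "G4 P i dvd f"
proof -
  obtain g where g: "X4 * f = G4 P i * g" using assms(2) by (auto elim: dvdE)
  have "X4 dvd G4 P i * g" unfolding g[symmetric] by (rule dvd_triv_left)
  then have "X4 dvd g"
    using prime_elem_dvd_multD[OF prime_elem_X4] X_not_dvd_G[OF assms(1)] by blast
  then obtain g' where "g = X4 * g'" by (auto elim: dvdE)
  then have "X4 * f = X4 * (G4 P i * g')" using g by (simp add: ac_simps)
  then have "f = G4 P i * g'" by simp
  then show ?thesis by simp
qed

text \<open>
  With \<open>H = X\<^sup>i T\<close> the Taylor formula reads \<open>\<Phi>(P) - P = X\<^sup>i (T P' + X\<^sup>i T\<^sup>2 q)\<close>, where \<open>P'\<close> is the derivative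
  in \<open>S\<close>, which is \<open>d S\<^sup>d\<^sup>-\<^sup>1\<close> modulo \<open>X\<close>. This value of \<open>L\<close> modulo \<open>X\<close> makes the equation for \<open>\<Phi>(T)\<close>
  solvable and is what the construction of the inverse rests on.
\<close>
lemma increment_quotient:
  assumes i: "i \<ge> 1" and \<Phi>: "alg_endo \<Phi>" "\<Phi> X4 = X4" "\<Phi> S4 = S4 + X4 ^ i * T4"
  shows "\<exists>L\<in>subring_XST. X4 ^ i * L = \<Phi> (emb P) - emb P \<and> X4 dvd L - of_nat d * T4 * S4 ^ (d - 1)"
proof -
  have H: "X4 ^ i * T4 \<in> (subring_XST :: 'k pol4 set)" by (simp add: XST_mult XST_power)
  obtain q where q: "q \<in> subring_XST"
      "\<Phi> (emb P) = emb P + X4 ^ i * T4 * emb (pderiv P) + (X4 ^ i * T4)\<^sup>2 * q"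
    using Taylor_S[OF \<Phi> H, of P] by blast
  define L where "L = T4 * emb (pderiv P) + X4 ^ i * T4\<^sup>2 * q"
  obtain j where j: "i = Suc j" using i by (cases i) auto
  have "L \<in> subring_XST"
    unfolding L_def by (intro XST_add XST_mult XST_power q) simp_all
  moreover have "X4 ^ i * L = \<Phi> (emb P) - emb P"
  proof -
    have "X4 ^ i * (T4 * D + X4 ^ i * T4\<^sup>2 * q) = (E + X4 ^ i * T4 * D + (X4 ^ i * T4)\<^sup>2 * q) - E"
      for D E :: "'k pol4"
      by (simp add: algebra_simps power2_eq_square)
    then show ?thesis unfolding L_def q(2) .
  qed
  moreover have "L - of_nat d * T4 * S4 ^ (d - 1)
      = X4 * (T4 * emb (pderiv Q) + X4 ^ j * T4\<^sup>2 * q)"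
  proof -
    have "T4 * (n * s + X4 * D) + X4 ^ i * T4\<^sup>2 * q - n * T4 * s
        = X4 * (T4 * D + X4 ^ j * T4\<^sup>2 * q)" for D n s :: "'k pol4"
      by (simp add: algebra_simps j)
    then show ?thesis unfolding L_def emb_pderiv_P .
  qed
  ultimately show ?thesis by (intro bexI[of _ L]) simp_all
qed

lemma ex1_Phi:
  assumes i: "i \<ge> 1"
  shows "\<exists>!\<Phi>. is_Phi d c P i \<Phi>"
proof (rule ex_ex1I)
  define H where "H = X4 ^ i * (T4 :: 'k pol4)"
  \<comment> \<open>\<open>P(X, S + H)\<close> depends only on the images of \<open>X\<close> and \<open>S\<close>,
    so any values for \<open>Y\<close> and \<open>T\<close> serve to find \<open>L\<close>.\<close>
  define \<Phi>0 where "\<Phi>0 = subst4 X4 (S4 + H) 0 (0 :: 'k pol4)"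
  have "\<exists>L\<in>subring_XST. X4 ^ i * L = \<Phi>0 (emb P) - emb P \<and> X4 dvd L - of_nat d * T4 * S4 ^ (d - 1)"
    using i by (intro increment_quotient) (simp_all add: \<Phi>0_def H_def alg_endo_subst4)
  then obtain L where L: "L \<in> subring_XST" "X4 ^ i * L = \<Phi>0 (emb P) - emb P"
      "X4 dvd L - of_nat d * T4 * S4 ^ (d - 1)"
    by blast
  from L(3) obtain r where r: "L = of_nat d * T4 * S4 ^ (d - 1) + X4 * r"
    using dvd_diffD by blast
  define target where "target = of_nat d * T4 * (- (X4 ^ (i + 1)) * Y4 + emb P - const4 c)"
  obtain j where j: "i = Suc j" using i by (cases i) auto
  obtain e where e: "d = Suc e" using d by (cases d) auto
  \<comment> \<open>The quotient by \<open>X\<close> of \<open>\<Phi>(Y) \<Phi>(S) - target\<close>: the terms \<open>\<plusminus> d T S\<^sup>d\<close> without a factor \<open>X\<close> cancel.\<close>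
  define W where "W = (Y4 + r) * (S4 + H) + of_nat d * T4 * S4 ^ e * (X4 ^ j * T4)
    + of_nat d * T4 * X4 ^ i * Y4 - of_nat d * T4 * emb Q"
  have W: "(X4 * Y4 + L) * (S4 + H) - X4 * W = target"
  proof -
    have "(X4 * Y4 + (n * T4 * S4 ^ e + X4 * r)) * (S4 + X4 ^ i * T4)
      - X4 * ((Y4 + r) * (S4 + X4 ^ i * T4) + n * T4 * S4 ^ e * (X4 ^ j * T4)
        + n * T4 * X4 ^ i * Y4 - n * T4 * q)
      = n * T4 * (- (X4 ^ (i + 1)) * Y4 + (S4 ^ d + X4 * q + k) - k)" for n q k :: "'k pol4"
      by (simp add: algebra_simps j e)
    note expand = this
    have "d - 1 = e" by (simp add: e)
    then show ?thesis unfolding W_def target_def r H_def emb_P by (simp only: expand)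
  qed
  define \<Phi> where "\<Phi> = subst4 X4 (S4 + H) (X4 * Y4 + L) W"
  have \<Phi>: "alg_endo \<Phi>" "\<Phi> X4 = X4" "\<Phi> S4 = S4 + H" "\<Phi> Y4 = X4 * Y4 + L" "\<Phi> T4 = W"
    by (simp_all add: \<Phi>_def alg_endo_subst4)
  interpret \<Phi>: unital_ring_hom \<Phi> using \<Phi>(1) by (simp add: alg_endo_iff)
  have "\<Phi> (emb P) = \<Phi>0 (emb P)"
    using alg_endo_agree_mod_XS[of \<Phi> \<Phi>0 0 P] \<Phi> by (simp add: \<Phi>0_def alg_endo_subst4)
  with L(2) have PL: "\<Phi> (emb P) - emb P = X4 ^ i * L" by simp
  then have "\<Phi> (emb P) = X4 ^ i * L + emb P" by (metis diff_eq_eq)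
  then have "\<Phi> (G4 P i) = X4 ^ i * (X4 * Y4 + L) - (X4 ^ i * L + emb P)"
    by (simp only: G4_def \<Phi>.hom_diff \<Phi>.hom_mult \<Phi>.hom_power \<Phi>)
  also have "\<dots> = G4 P (i + 1)"
    by (simp add: G4_def algebra_simps)
  finally have "\<Phi> (G4 P i) = G4 P (i + 1)" .
  moreover have "\<Phi> (Y4 * S4 - X4 * T4) = target"
    using W by (simp add: \<Phi>)
  ultimately show "\<exists>\<Phi>. is_Phi d c P i \<Phi>"
    unfolding is_Phi_def using \<Phi>(1-4) L(1) PL[symmetric] by (auto simp: H_def target_def)
next
  fix f g assume f: "is_Phi d c P i f" and g: "is_Phi d c P i g"
  interpret f: unital_ring_hom f using f by (simp add: alg_endo_iff is_Phi_def)
  interpret g: unital_ring_hom g using g by (simp add: alg_endo_iff is_Phi_def)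
  have endo: "alg_endo f" "alg_endo g" and X: "f X4 = X4" "g X4 = X4" and S: "f S4 = g S4"
    using f g by (simp_all add: is_Phi_def)
  have eq: "f (Y4 * S4 - X4 * T4) = g (Y4 * S4 - X4 * T4)"
    using f g unfolding is_Phi_def by metis
  have "f (emb P) = g (emb P)"
    using alg_endo_agree_mod_XS[OF endo, of 0 P] X S by simp
  moreover obtain L where fY: "f Y4 = X4 * Y4 + L" "X4 ^ i * L = f (emb P) - emb P"
    using f by (auto simp: is_Phi_def)
  moreover obtain L' where gY: "g Y4 = X4 * Y4 + L'" "X4 ^ i * L' = g (emb P) - emb P"
    using g by (auto simp: is_Phi_def)
  ultimately have "X4 ^ i * L = X4 ^ i * L'" by simp
  then have "L = L'" by simp
  then have Y: "f Y4 = g Y4" by (simp add: fY gY)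
  have "X4 * f T4 = X4 * g T4" using eq by (simp add: X S Y)
  then have T: "f T4 = g T4" by simp
  show "f = g"
    using alg_endo_agree_mod[OF endo, of 0] X S Y T by auto
qed

text \<open>
  The inverse of the induced isomorphism, lifted to an endomorphism \<open>\<Psi>\<close> of \<open>k[X,S,Y,T]\<close>. Its value \<open>y\<close>
  at \<open>Y\<close> is a quotient by \<open>X\<close> that exists modulo \<open>G\<^sub>i\<close>. The two compositions are compared with the
  identity on the variables; the cases \<open>\<Psi>(\<Phi>(T))\<close> and \<open>\<Phi>(\<Psi>(Y))\<close> are obtained from their multiples by \<open>X\<close>.
\<close>
lemma Phi_inverse_mod:
  assumes i: "i \<ge> 1" and Phi: "is_Phi d c P i \<Phi>"
  shows "\<exists>\<Psi>. alg_endo \<Psi> \<and> G4 P i dvd \<Psi> (G4 P (i + 1))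
    \<and> (\<forall>p. G4 P i dvd \<Psi> (\<Phi> p) - p) \<and> (\<forall>p. G4 P (i + 1) dvd \<Phi> (\<Psi> p) - p)"
proof -
  define G where "G = G4 P i"
  define G' where "G' = G4 P (i + 1)"
  have endo: "alg_endo \<Phi>" and \<Phi>X: "\<Phi> X4 = X4" and \<Phi>S: "\<Phi> S4 = S4 + X4 ^ i * T4"
    and \<Phi>G: "\<Phi> G = G'"
    and \<Phi>YS: "\<Phi> (Y4 * S4 - X4 * T4) = of_nat d * T4 * (- (X4 ^ (i + 1)) * Y4 + emb P - const4 c)"
    using Phi by (simp_all add: is_Phi_def G_def G'_def)
  interpret \<Phi>: unital_ring_hom \<Phi> using endo by (simp add: alg_endo_iff)
  have \<Phi>YS: "\<Phi> (Y4 * S4 - X4 * T4) = - (of_nat d * T4 * (G' + const4 c))"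
  proof -
    have "n * T4 * (- (X4 ^ (i + 1)) * Y4 + E - k) = - (n * T4 * ((X4 ^ (i + 1) * Y4 - E) + k))"
      for n E k :: "'k pol4"
      by (simp add: algebra_simps)
    then show ?thesis unfolding \<Phi>YS G'_def G4_def .
  qed
  obtain L where L: "L \<in> subring_XST" and \<Phi>Y: "\<Phi> Y4 = X4 * Y4 + L"
    and XL: "X4 ^ i * L = \<Phi> (emb P) - emb P"
    using Phi by (auto simp: is_Phi_def)
  obtain L' where L': "X4 ^ i * L' = \<Phi> (emb P) - emb P" "X4 dvd L' - of_nat d * T4 * S4 ^ (d - 1)"
    using increment_quotient[OF i endo \<Phi>X \<Phi>S] by blast
  have "X4 ^ i * L' = X4 ^ i * L" using XL L'(1) by simp
  then have "L' = L" by simp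
  with L'(2) have "X4 dvd L - of_nat d * T4 * S4 ^ (d - 1)" by simp
  then obtain r where r: "L = of_nat d * T4 * S4 ^ (d - 1) + X4 * r"
    using dvd_diffD by blast
  obtain j where j: "i = Suc j" using i by (cases i) auto
  obtain e where e: "d = Suc e" using d by (cases d) auto
  define \<kappa> :: "'k pol4" where "\<kappa> = const4 (inverse (of_nat d * c))"
  \<comment> \<open>The values of \<open>\<Psi>\<close> at \<open>T\<close> and \<open>S\<close> are forced by \<open>\<Phi>(Y S - X T) \<equiv> - d c T\<close> and \<open>\<Phi>(S) = S + X\<^sup>i T\<close>.\<close>
  define t where "t = - \<kappa> * (Y4 * S4 - X4 * T4)"
  define s where "s = S4 - X4 ^ i * t"
  have \<kappa>: "\<kappa> * of_nat d * const4 c = 1"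
  proof -
    interpret c: unital_ring_hom "const4 :: 'k \<Rightarrow> _"
      by unfold_locales (simp_all add: const4_def const3_def const2_def one_pCons)
    have "\<kappa> * of_nat d * const4 c = const4 (inverse (of_nat d * c) * of_nat d * c)"
      by (simp only: \<kappa>_def c.hom_mult c.hom_of_nat)
    also have "inverse (of_nat d * c) * of_nat d * c = 1" using c d by (simp add: field_simps)
    finally show ?thesis by simp
  qed
  \<comment> \<open>\<open>L(X, s, t)\<close> is needed before \<open>y\<close> is known;
    as \<open>L\<close> does not involve \<open>Y\<close>, the value \<open>0\<close> at \<open>Y\<close> does no harm.\<close>
  define \<Psi>0 where "\<Psi>0 = subst4 X4 s 0 t"
  interpret \<Psi>0: unital_ring_hom \<Psi>0
    using alg_endo_subst4[of X4 s 0 t] by (simp add: alg_endo_iff \<Psi>0_def)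
  \<comment> \<open>\<open>Y'\<close> is what \<open>\<Psi>(X Y) = \<Psi>(\<Phi>(Y) - L)\<close> has to be.\<close>
  define Y' where "Y' = Y4 - \<Psi>0 L"
  have "\<exists>y. G dvd X4 * y - Y'"
  proof -
    have "X4 dvd s - S4" by (simp add: s_def j)
    then have "X4 dvd s ^ e - S4 ^ e" by (rule dvd_diff_power)
    then obtain r2 where r2: "s ^ e = S4 ^ e + X4 * r2"
      using dvd_diffD by blast
    have \<Psi>L: "\<Psi>0 L = of_nat d * t * (S4 ^ e + X4 * r2) + X4 * \<Psi>0 r"
      unfolding r by (simp add: \<Psi>0_def[symmetric]) (simp add: \<Psi>0_def e r2)
    define \<gamma> where "\<gamma> = \<kappa> * of_nat d"
    have \<gamma>: "\<gamma> * const4 c = 1" using \<kappa> by (simp add: \<gamma>_def)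
    \<comment> \<open>The terms of \<open>Y - L(X, s, t)\<close> that lack a factor \<open>X\<close> add up to a multiple
      of \<open>P - X Q\<close>, and \<open>P\<close> is \<open>X\<^sup>i Y\<close> modulo \<open>G\<^sub>i\<close>.\<close>
    define y where "y = \<gamma> * Y4 * X4 ^ j * Y4 - \<gamma> * Y4 * emb Q - \<gamma> * T4 * S4 ^ e
      + \<gamma> * (Y4 * S4 - X4 * T4) * r2 - \<Psi>0 r"
    have "X4 * (\<kappa> * n * Y4 * X4 ^ j * Y4 - \<kappa> * n * Y4 * q - \<kappa> * n * T4 * S4 ^ e
        + \<kappa> * n * (Y4 * S4 - X4 * T4) * r2 - \<rho>)
      - (Y4 - (n * (- \<kappa> * (Y4 * S4 - X4 * T4)) * (S4 ^ e + X4 * r2) + X4 * \<rho>))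
      = \<kappa> * n * Y4 * (X4 ^ i * Y4 - (S4 ^ d + X4 * q + k)) + (\<kappa> * n * k - 1) * Y4"
      for n q k \<rho> :: "'k pol4"
      by (simp add: algebra_simps j e)
    then have "X4 * y - Y' = \<gamma> * Y4 * G + (\<gamma> * const4 c - 1) * Y4"
      unfolding y_def Y'_def \<Psi>L G_def G4_def emb_P t_def \<gamma>_def .
    then have "X4 * y - Y' = \<gamma> * Y4 * G" by (simp add: \<gamma>)
    then show ?thesis by (intro exI[of _ y]) simp
  qed
  then obtain y where y: "G dvd X4 * y - Y'" by blast
  define \<Psi> where "\<Psi> = subst4 X4 s y t"
  have \<Psi>endo: "alg_endo \<Psi>" and \<Psi>: "\<Psi> X4 = X4" "\<Psi> S4 = s" "\<Psi> Y4 = y" "\<Psi> T4 = t"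
    by (simp_all add: \<Psi>_def alg_endo_subst4)
  interpret \<Psi>: unital_ring_hom \<Psi> using \<Psi>endo by (simp add: alg_endo_iff)
  note \<Psi>\<Phi>endo = alg_endo_comp[OF \<Psi>endo endo] and \<Phi>\<Psi>endo = alg_endo_comp[OF endo \<Psi>endo]
  have "\<Psi> L = \<Psi>0 L"
    using alg_endo_agree_mod_XST[of \<Psi> \<Psi>0 0 L] L \<Psi> \<Psi>endo by (simp add: \<Psi>0_def alg_endo_subst4)
  then have Y': "Y' = Y4 - \<Psi> L" by (simp add: Y'_def)
  have \<Psi>\<Phi>S: "\<Psi> (\<Phi> S4) = S4" by (simp add: \<Phi>S \<Psi> s_def)
  have \<Psi>\<Phi>P: "\<Psi> (\<Phi> (emb P)) = emb P"
    using alg_endo_agree_mod_XS[OF \<Psi>\<Phi>endo alg_endo_id, of 0 P] by (simp add: \<Psi>\<Phi>S \<Phi>X \<Psi>)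
  \<comment> \<open>Since \<open>\<Psi>\<close> undoes \<open>\<Phi>\<close> on \<open>P\<close>, applying \<open>\<Psi>\<close> to the equation
    that defines \<open>L\<close> expresses \<open>\<Psi>(P)\<close> by \<open>\<Psi>(L)\<close>.\<close>
  have "X4 ^ i * \<Psi> L = \<Psi> (X4 ^ i * L)" by (simp add: \<Psi>)
  also have "\<dots> = emb P - \<Psi> (emb P)" by (simp only: XL \<Psi>.hom_diff \<Psi>\<Phi>P)
  finally have "\<Psi> (emb P) = emb P - X4 ^ i * \<Psi> L" by (simp only: algebra_simps)
  then have "\<Psi> G' = X4 ^ (i + 1) * y - (emb P - X4 ^ i * \<Psi> L)"
    by (simp only: G'_def G4_def \<Psi>.hom_diff \<Psi>.hom_mult \<Psi>.hom_power \<Psi>)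
  also have "\<dots> = X4 ^ i * (X4 * y - Y') + G"
    unfolding Y' G_def G4_def by (simp only: algebra_simps power_add power_one_right)
  finally have \<Psi>G': "G dvd \<Psi> G'" using y by simp
  have "\<Psi> (\<Phi> Y4) - Y4 = X4 * y - Y'" by (simp add: \<Phi>Y \<Psi> Y')
  with y have \<Psi>\<Phi>Y: "G dvd \<Psi> (\<Phi> Y4) - Y4" by simp
  have dtc: "of_nat d * t * const4 c = - (Y4 * S4 - X4 * T4)"
  proof -
    have "of_nat d * t * const4 c = - (\<kappa> * of_nat d * const4 c) * (Y4 * S4 - X4 * T4)"
      by (simp add: t_def algebra_simps)
    then show ?thesis by (simp add: \<kappa>)
  qed
  have const: "\<Psi> (const4 c) = const4 c" "\<Phi> \<kappa> = \<kappa>"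
    using \<Psi>endo endo by (simp_all add: alg_endo_iff \<kappa>_def)
  \<comment> \<open>Applying \<open>\<Psi>\<close> to requirement (b) determines \<open>X \<Psi>(\<Phi>(T))\<close> modulo \<open>G\<^sub>i\<close>.\<close>
  have "\<Psi> (\<Phi> Y4) * S4 - X4 * \<Psi> (\<Phi> T4) = \<Psi> (\<Phi> (Y4 * S4 - X4 * T4))"
    by (simp add: \<Psi>\<Phi>S \<Psi> \<Phi>X)
  also have "\<dots> = - (of_nat d * t * \<Psi> G') - of_nat d * t * const4 c"
    unfolding \<Phi>YS by (simp add: \<Psi> const algebra_simps)
  also have "\<dots> = - (of_nat d * t * \<Psi> G') + (Y4 * S4 - X4 * T4)"
    unfolding dtc by simp
  finally have "of_nat d * t * \<Psi> G'
      = (Y4 * S4 - X4 * T4) - (\<Psi> (\<Phi> Y4) * S4 - X4 * \<Psi> (\<Phi> T4))"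
    by simp
  then have "X4 * (\<Psi> (\<Phi> T4) - T4) = (\<Psi> (\<Phi> Y4) - Y4) * S4 + of_nat d * t * \<Psi> G'"
    by (simp add: algebra_simps)
  with \<Psi>\<Phi>Y \<Psi>G' have "G dvd X4 * (\<Psi> (\<Phi> T4) - T4)" by simp
  then have \<Psi>\<Phi>T: "G dvd \<Psi> (\<Phi> T4) - T4" unfolding G_def by (rule X_cancel_mod_G[OF i])
  have \<Psi>\<Phi>: "G dvd \<Psi> (\<Phi> p) - p" for p
    by (rule alg_endo_agree_mod[OF \<Psi>\<Phi>endo alg_endo_id])
      (use \<Psi>\<Phi>Y \<Psi>\<Phi>T in \<open>simp_all add: \<Psi>\<Phi>S \<Phi>X \<Psi>\<close>)
  have "\<Phi> t = \<kappa> * (of_nat d * T4 * (G' + const4 c))"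
    unfolding t_def \<Phi>.hom_mult[of "- \<kappa>"] \<Phi>YS by (simp add: const)
  also have "\<dots> = (\<kappa> * of_nat d * const4 c) * T4 + \<kappa> * of_nat d * T4 * G'"
    by (simp add: algebra_simps)
  finally have \<Phi>\<Psi>T: "G' dvd \<Phi> t - T4" by (simp add: \<kappa>)
  have "\<Phi> s - S4 = - (X4 ^ i * (\<Phi> t - T4))" by (simp add: s_def \<Phi>S \<Phi>X algebra_simps)
  with \<Phi>\<Psi>T have \<Phi>\<Psi>S: "G' dvd \<Phi> s - S4" by simp
  have \<Phi>\<Psi>L: "G' dvd \<Phi> (\<Psi> L) - L"
    by (rule alg_endo_agree_mod_XST[OF \<Phi>\<Psi>endo alg_endo_id])
      (use \<Phi>\<Psi>S \<Phi>\<Psi>T L in \<open>simp_all add: \<Phi>X \<Psi>\<close>)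
  \<comment> \<open>Applying \<open>\<Phi>\<close> to the congruence that defines \<open>y\<close> determines \<open>X \<Phi>(y)\<close> modulo \<open>G\<^sub>i\<^sub>+\<^sub>1\<close>.\<close>
  have "G' dvd \<Phi> (X4 * y - Y')" using \<Phi>.hom_dvd[OF y] unfolding \<Phi>G .
  also have "\<Phi> (X4 * y - Y') = X4 * (\<Phi> y - Y4) + (\<Phi> (\<Psi> L) - L)"
    unfolding Y' by (simp add: \<Phi>X \<Phi>Y algebra_simps)
  finally have "G' dvd X4 * (\<Phi> y - Y4)" by (simp only: dvd_add_left_iff[OF \<Phi>\<Psi>L])
  then have \<Phi>\<Psi>Y: "G' dvd \<Phi> y - Y4" unfolding G'_def by (rule X_cancel_mod_G[OF le_add2])
  have \<Phi>\<Psi>: "G' dvd \<Phi> (\<Psi> p) - p" for p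
    by (rule alg_endo_agree_mod[OF \<Phi>\<Psi>endo alg_endo_id])
      (use \<Phi>\<Psi>S \<Phi>\<Psi>T \<Phi>\<Psi>Y in \<open>simp_all add: \<Phi>X \<Psi>\<close>)
  show ?thesis
    unfolding G_def[symmetric] G'_def[symmetric]
    by (intro exI[of _ \<Psi>] conjI allI \<Psi>endo \<Psi>G' \<Psi>\<Phi> \<Phi>\<Psi>)
qed

text \<open>
  Together these properties say that the composite induces a well-defined, injective and surjective
  map of the quotients. The induction starts at the identity for \<open>m = n\<close>.
\<close>
lemma fold_Phi_bijective_mod:
  assumes "1 \<le> n" "n \<le> m" "\<forall>i\<in>{n..<m}. is_Phi d c P i (\<Phi> i)"
  shows "alg_endo (fold \<Phi> [n..<m]) \<and> G4 P m dvd fold \<Phi> [n..<m] (G4 P n)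
    \<and> (\<forall>p. G4 P m dvd fold \<Phi> [n..<m] p \<longrightarrow> G4 P n dvd p)
    \<and> (\<forall>p. \<exists>q. G4 P m dvd fold \<Phi> [n..<m] q - p)"
  using assms(2,3)
proof (induction m rule: dec_induct)
  case base
  have "\<exists>q. G4 P n dvd q - p" for p by (rule exI[of _ p]) simp
  then show ?case by (simp add: alg_endo_id id_def)
next
  case (step m)
  define F where "F = fold \<Phi> [n..<m]"
  have F: "alg_endo F" "G4 P m dvd F (G4 P n)" "\<And>p. G4 P m dvd F p \<Longrightarrow> G4 P n dvd p"
      "\<And>p. \<exists>q. G4 P m dvd F q - p"
    using step.IH step.prems unfolding F_def by auto
  have fold_Suc: "fold \<Phi> [n..<Suc m] = (\<lambda>p. \<Phi> m (F p))"
    using step.hyps by (auto simp: F_def)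
  have m: "m \<ge> 1" and Phi: "is_Phi d c P m (\<Phi> m)"
    using assms(1) step.hyps step.prems by auto
  have endo: "alg_endo (\<Phi> m)" and relation: "\<Phi> m (G4 P m) = G4 P (Suc m)"
    using Phi by (simp_all add: is_Phi_def)
  interpret \<Phi>: unital_ring_hom "\<Phi> m" using endo by (simp add: alg_endo_iff)
  obtain \<Psi> where \<Psi>: "alg_endo \<Psi>" "G4 P m dvd \<Psi> (G4 P (Suc m))"
      "\<And>p. G4 P m dvd \<Psi> (\<Phi> m p) - p" "\<And>p. G4 P (Suc m) dvd \<Phi> m (\<Psi> p) - p"
    using Phi_inverse_mod[OF m Phi] by auto
  interpret \<Psi>: unital_ring_hom \<Psi> using \<Psi>(1) by (simp add: alg_endo_iff)
  have "G4 P n dvd p" if "G4 P (Suc m) dvd \<Phi> m (F p)" for p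
  proof (rule F(3))
    have "G4 P m dvd \<Psi> (\<Phi> m (F p))" using \<Psi>(2) \<Psi>.hom_dvd[OF that] by (rule dvd_trans)
    from dvd_diff[OF this \<Psi>(3)[of "F p"]] show "G4 P m dvd F p" by simp
  qed
  moreover have "\<exists>q. G4 P (Suc m) dvd \<Phi> m (F q) - p" for p
  proof -
    obtain q where "G4 P m dvd F q - \<Psi> p" using F(4) by blast
    from \<Phi>.hom_dvd[OF this] have "G4 P (Suc m) dvd \<Phi> m (F q) - \<Phi> m (\<Psi> p)"
      by (simp only: relation \<Phi>.hom_diff)
    then have "G4 P (Suc m) dvd \<Phi> m (F q) - p" using \<Psi>(4) by (rule dvd_diff_trans)
    then show ?thesis ..
  qed
  moreover have "G4 P (Suc m) dvd \<Phi> m (F (G4 P n))"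
    using \<Phi>.hom_dvd[OF F(2)] unfolding relation .
  moreover have "alg_endo (\<lambda>p. \<Phi> m (F p))" by (rule alg_endo_comp[OF endo F(1)])
  ultimately show ?case unfolding fold_Suc by blast
qed

end

section \<open>Quotients by principal ideals\<close>

lemma ring_of_type_simps [simp]:
  "carrier ring_of_type_algebra = (UNIV :: 'a::comm_ring_1 set)"
  "x \<otimes>\<^bsub>ring_of_type_algebra\<^esub> y = x * (y :: 'a)"
  "x \<oplus>\<^bsub>ring_of_type_algebra\<^esub> y = x + (y :: 'a)"
  "\<one>\<^bsub>ring_of_type_algebra\<^esub> = (1 :: 'a)"
  "\<zero>\<^bsub>ring_of_type_algebra\<^esub> = (0 :: 'a)"
  by (simp_all add: ring_of_type_algebra_def)

abbreviation principal_ideal :: "'a::comm_ring_1 \<Rightarrow> 'a set"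
  where "principal_ideal g \<equiv> PIdl\<^bsub>ring_of_type_algebra\<^esub> g"

abbreviation residue :: "'a::comm_ring_1 \<Rightarrow> 'a \<Rightarrow> 'a set"
  where "residue g x \<equiv> principal_ideal g +>\<^bsub>ring_of_type_algebra\<^esub> x"

abbreviation residue_algebra :: "'a::comm_ring_1 \<Rightarrow> 'a set ring"
  where "residue_algebra g \<equiv> ring_of_type_algebra Quot principal_ideal g"

lemma mem_principal_ideal: "x \<in> principal_ideal g \<longleftrightarrow> g dvd x"
  by (auto simp: cgenideal_def dvd_def mult.commute)

lemma residue_eq_Collect: "residue g x = {y. g dvd y - x}"
  by (auto simp: a_r_coset_def' mem_principal_ideal)

lemma residue_eq_iff: "residue g x = residue g y \<longleftrightarrow> g dvd x - y"
proof
  assume eq: "residue g x = residue g y"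
  have "x \<in> residue g x" unfolding residue_eq_Collect by simp
  then have "x \<in> residue g y" unfolding eq .
  then show "g dvd x - y" unfolding residue_eq_Collect by simp
next
  assume xy: "g dvd x - y"
  have "g dvd - (x - y)" using xy unfolding dvd_minus_iff .
  then have yx: "g dvd y - x" unfolding minus_diff_eq .
  show "residue g x = residue g y"
    unfolding residue_eq_Collect using dvd_diff_trans[OF _ xy] dvd_diff_trans[OF _ yx]
    by (intro Collect_cong iffI)
qed

lemma ideal_principal_ideal: "ideal (principal_ideal g) ring_of_type_algebra"
  by (rule cring.cgenideal_ideal[OF cring_from_type_algebra]) simp

lemma residue_hom: "ring_hom_ring ring_of_type_algebra (residue_algebra g) (residue g)"
  by (rule ideal.rcos_ring_hom_ring[OF ideal_principal_ideal])

lemma cring_residue_algebra: "cring (residue_algebra g)"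
  by (rule ideal.quotient_is_cring[OF ideal_principal_ideal cring_from_type_algebra])

lemma carrier_residue_algebra: "carrier (residue_algebra g) = range (residue g)"
  by (simp add: FactRing_def A_RCOSETS_def' UNION_singleton_eq_range)

lemma zero_residue_algebra: "\<zero>\<^bsub>residue_algebra g\<^esub> = residue g 0"
  unfolding residue_eq_Collect by (auto simp: FactRing_def mem_principal_ideal)

text \<open>
  The first isomorphism theorem, with the value of the isomorphism on each residue class.
\<close>
lemma residue_algebra_iso:
  assumes hom: "ring_hom_ring ring_of_type_algebra S h"
    and surj: "range h = carrier S"
    and kernel: "\<And>x. h x = \<zero>\<^bsub>S\<^esub> \<longleftrightarrow> g dvd x"
  shows "\<exists>\<phi>\<in>ring_iso (residue_algebra g) S. \<forall>x. \<phi> (residue g x) = h x"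
proof -
  interpret ring_hom_ring ring_of_type_algebra S h by fact
  have ker: "a_kernel ring_of_type_algebra S h = principal_ideal g"
    unfolding a_kernel_def' set_eq_iff mem_principal_ideal by (simp add: kernel)
  have image: "S\<lparr>carrier := h ` carrier ring_of_type_algebra\<rparr> = S"
    unfolding ring_of_type_simps surj by simp
  have "(\<lambda>C. the_elem (h ` C)) \<in> ring_iso (residue_algebra g) S"
    using FactRing_iso_set_aux unfolding ker image .
  moreover have "the_elem (h ` residue g x) = h x" for x
    using the_elem_simp[of x] by (simp add: ker)
  ultimately show ?thesis by (intro bexI[of _ "\<lambda>C. the_elem (h ` C)"] allI)
qed

lemma BT4_as_residue_algebra: "BT4 P n = residue_algebra (G4 P n)" "BT4_ideal P n = principal_ideal (G4 P n)"
  by (simp_all add: BT4_def BT4_ideal_def)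

lemma induces_isoI:
  assumes endo: "alg_endo \<Phi>"
    and relation: "G4 P j dvd \<Phi> (G4 P i)"
    and injective: "\<And>p. G4 P j dvd \<Phi> p \<Longrightarrow> G4 P i dvd p"
    and surjective: "\<And>p. \<exists>q. G4 P j dvd \<Phi> q - p"
  shows "induces_iso P i j \<Phi>"
proof -
  interpret \<Phi>: unital_ring_hom \<Phi> using endo by (simp add: alg_endo_iff)
  have "\<Phi> \<in> ring_hom k4 k4" using endo by (simp add: alg_endo_def alg_hom_def)
  then have "residue (G4 P j) \<circ> \<Phi> \<in> ring_hom k4 (residue_algebra (G4 P j))"
    using ring_hom_ring.homh[OF residue_hom] by (rule ring_hom_trans)
  then have hom: "ring_hom_ring k4 (residue_algebra (G4 P j)) (\<lambda>p. residue (G4 P j) (\<Phi> p))"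
    by (intro ring_hom_ringI2 ring_from_type_algebra cring.axioms(1) cring_residue_algebra)
      (simp add: comp_def)
  have onto: "range (\<lambda>p. residue (G4 P j) (\<Phi> p)) = carrier (residue_algebra (G4 P j))"
  proof -
    have "residue (G4 P j) p \<in> range (\<lambda>p. residue (G4 P j) (\<Phi> p))" for p
    proof -
      obtain q where "G4 P j dvd \<Phi> q - p" using surjective by blast
      then have "residue (G4 P j) (\<Phi> q) = residue (G4 P j) p" by (simp only: residue_eq_iff)
      then show ?thesis by (metis rangeI)
    qed
    then show ?thesis unfolding carrier_residue_algebra by auto
  qed
  have kernel: "residue (G4 P j) (\<Phi> p) = \<zero>\<^bsub>residue_algebra (G4 P j)\<^esub> \<longleftrightarrow> G4 P i dvd p" for p
  proof -
    have "G4 P j dvd \<Phi> p" if "G4 P i dvd p"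
      using relation \<Phi>.hom_dvd[OF that] by (rule dvd_trans)
    with injective[of p] show ?thesis
      unfolding zero_residue_algebra residue_eq_iff diff_zero by blast
  qed
  obtain \<phi> where \<phi>: "\<phi> \<in> ring_iso (residue_algebra (G4 P i)) (residue_algebra (G4 P j))"
      "\<And>p. \<phi> (residue (G4 P i) p) = residue (G4 P j) (\<Phi> p)"
    using residue_algebra_iso[OF hom onto kernel] by blast
  then have "\<phi> \<in> alg_iso (BT4 P i) (BT4_const P i) (BT4 P j) (BT4_const P j)"
    using endo by (simp add: alg_iso_def BT4_as_residue_algebra BT4_const_def alg_endo_iff)
  moreover have "\<Phi> (G4 P i) \<in> BT4_ideal P j" using relation by (simp only: BT4_as_residue_algebra mem_principal_ideal)
  moreover have "\<forall>p. \<phi> (residue (G4 P i) p) = residue (G4 P j) (\<Phi> p)" using \<phi>(2) by blast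
  ultimately show ?thesis
    unfolding induces_iso_def using endo unfolding BT4_as_residue_algebra by blast
qed

section \<open>Polynomials over a quotient as a quotient of polynomials\<close>

lemma alg_isomorphic_refl: "alg_isomorphic R \<iota> R \<iota>"
proof -
  have "id \<in> alg_iso R \<iota> R \<iota>" by (simp add: alg_iso_def ring_iso_set_refl)
  then show ?thesis by (auto simp: alg_isomorphic_def)
qed

lemma alg_isomorphic_trans:
  assumes "alg_isomorphic R \<iota> S \<kappa>" "alg_isomorphic S \<kappa> U \<mu>"
  shows "alg_isomorphic R \<iota> U \<mu>"
proof -
  obtain f g where "f \<in> ring_iso R S" "\<And>a. f (\<iota> a) = \<kappa> a" "g \<in> ring_iso S U" "\<And>a. g (\<kappa> a) = \<mu> a"
    using assms by (auto simp: alg_isomorphic_def alg_iso_def)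
  then have "g \<circ> f \<in> alg_iso R \<iota> U \<mu>" by (simp add: alg_iso_def ring_iso_set_trans)
  then show ?thesis by (auto simp: alg_isomorphic_def)
qed

lemma alg_isomorphic_sym:
  assumes "ring R" "\<And>a. \<iota> a \<in> carrier R" "alg_isomorphic R \<iota> S \<kappa>"
  shows "alg_isomorphic S \<kappa> R \<iota>"
proof -
  obtain f where f: "f \<in> ring_iso R S" and const: "\<And>a. f (\<iota> a) = \<kappa> a"
    using assms(3) by (auto simp: alg_isomorphic_def alg_iso_def)
  have "inv_into (carrier R) f (\<kappa> a) = \<iota> a" for a
    using ring_iso_memE(5)[OF f] assms(2) const by (metis bij_betw_inv_into_left)
  then have "inv_into (carrier R) f \<in> alg_iso S \<kappa> R \<iota>"
    using ring_iso_set_sym[OF assms(1) f] by (simp add: alg_iso_def)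
  then show ?thesis by (auto simp: alg_isomorphic_def)
qed

lemma finsum_residue:
  assumes "finite A"
  shows "(\<Oplus>\<^bsub>residue_algebra g\<^esub>i\<in>A. residue g (f i)) = residue g (sum f A)"
proof -
  interpret Q: cring "residue_algebra g" by (rule cring_residue_algebra)
  interpret \<pi>: ring_hom_ring ring_of_type_algebra "residue_algebra g" "residue g" by (rule residue_hom)
  have "range (residue g) = carrier (residue_algebra g)" by (rule carrier_residue_algebra[symmetric])
  then have mem: "residue g x \<in> carrier (residue_algebra g)" for x by blast
  have add: "residue g (x + y) = residue g x \<oplus>\<^bsub>residue_algebra g\<^esub> residue g y" for x y
    using \<pi>.hom_add[of x y] by simp
  show ?thesis
    using assms by (induction A) (simp_all add: zero_residue_algebra mem add)
qed

text \<open>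
  The reduction homomorphism \<open>R[T] \<rightarrow> (R / (g))[T]\<close>. Its source is a type of polynomials and its target
  consists of finitely supported sequences of residue classes.
\<close>
definition residue_coeffs :: "'a::comm_ring_1 \<Rightarrow> 'a poly \<Rightarrow> nat \<Rightarrow> 'a set"
  where "residue_coeffs g p = (\<lambda>j. residue g (poly.coeff p j))"

lemma range_residue_coeffs: "range (residue_coeffs g) = carrier (UP (residue_algebra g))"
proof (intro equalityI subsetI)
  fix u assume "u \<in> range (residue_coeffs g)"
  then obtain p where u: "u = residue_coeffs g p" by blast
  have "bound \<zero>\<^bsub>residue_algebra g\<^esub> (degree p) u"
    by (auto simp: u residue_coeffs_def zero_residue_algebra coeff_eq_0)
  then show "u \<in> carrier (UP (residue_algebra g))"
    by (auto simp: UP_def u residue_coeffs_def carrier_residue_algebra intro!: mem_upI)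
next
  fix u assume "u \<in> carrier (UP (residue_algebra g))"
  then have u: "u \<in> up (residue_algebra g)" by (simp add: UP_def)
  then obtain n where n: "bound \<zero>\<^bsub>residue_algebra g\<^esub> n u" by (auto simp: up_def)
  have "\<forall>j. \<exists>a. u j = residue g a" using mem_upD[OF u] unfolding carrier_residue_algebra by blast
  then obtain a where a: "\<And>j. u j = residue g (a j)" by metis
  define p where "p = Poly (map a [0..<Suc n])"
  have coeff_p: "poly.coeff p j = (if j \<le> n then a j else 0)" for j
    by (auto simp: p_def coeff_Poly_eq nth_default_def simp del: upt_Suc)
  have beyond: "u j = residue g 0" if "\<not> j \<le> n" for j
    using bound.bound[OF n, of j] that by (simp add: zero_residue_algebra)
  have "u j = residue_coeffs g p j" for j
    using a beyond by (cases "j \<le> n") (simp_all add: residue_coeffs_def coeff_p)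
  then have "u = residue_coeffs g p" by (rule ext)
  then show "u \<in> range (residue_coeffs g)" by blast
qed

lemma residue_coeffs_hom:
  "ring_hom_ring ring_of_type_algebra (UP (residue_algebra g)) (residue_coeffs g)"
proof (intro ring_hom_ringI2 ring_from_type_algebra ring_hom_memI)
  show "ring (UP (residue_algebra g))"
    by (intro UP_ring.UP_ring UP_ring.intro cring.axioms(1) cring_residue_algebra)
  interpret \<pi>: ring_hom_ring ring_of_type_algebra "residue_algebra g" "residue g" by (rule residue_hom)
  have mem: "residue_coeffs g p \<in> up (residue_algebra g)" for p
    using range_residue_coeffs[of g] by (auto simp: UP_def)
  show "residue_coeffs g p \<in> carrier (UP (residue_algebra g))" for p
    using mem by (simp add: UP_def)
  have add: "residue g (x + y) = residue g x \<oplus>\<^bsub>residue_algebra g\<^esub> residue g y" for x y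
    using \<pi>.hom_add[of x y] by simp
  have mult: "residue g x \<otimes>\<^bsub>residue_algebra g\<^esub> residue g y = residue g (x * y)" for x y
    using \<pi>.hom_mult[of x y] by simp
  have one: "\<one>\<^bsub>residue_algebra g\<^esub> = residue g 1"
    using \<pi>.hom_one by simp
  show "residue_coeffs g (p \<oplus>\<^bsub>ring_of_type_algebra\<^esub> q)
      = residue_coeffs g p \<oplus>\<^bsub>UP (residue_algebra g)\<^esub> residue_coeffs g q" for p q
    using mem[of p] mem[of q] by (simp add: UP_def) (simp add: residue_coeffs_def add)
  show "residue_coeffs g (p \<otimes>\<^bsub>ring_of_type_algebra\<^esub> q)
      = residue_coeffs g p \<otimes>\<^bsub>UP (residue_algebra g)\<^esub> residue_coeffs g q" for p q
    using mem[of p] mem[of q]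
    by (simp add: UP_def) (simp add: residue_coeffs_def mult finsum_residue Polynomial.coeff_mult)
  show "residue_coeffs g \<one>\<^bsub>ring_of_type_algebra\<^esub> = \<one>\<^bsub>UP (residue_algebra g)\<^esub>"
    by (simp add: UP_def residue_coeffs_def fun_eq_iff one zero_residue_algebra)
qed

text \<open>
  The kernel of the reduction of coefficients consists of the polynomials all of whose coefficients
  are divisible by \<open>X\<^sup>n Y - P\<close>, that is, of the multiples of this constant polynomial in \<open>T\<close>.
\<close>
lemma BT4_isomorphic_BT:
  fixes P :: "'k::field pol2"
  shows "alg_isomorphic (BT4 P n) (BT4_const P n) (BT P n) (BT_const P n)"
proof -
  have G4: "G4 P n = [:G3 P n:]"
  proof -
    have "(X4 :: 'k pol4) ^ n = [:X3 ^ n:]" for n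
      by (induction n) (simp_all add: X4_def one_pCons)
    then show ?thesis unfolding G4_def G3_def Y4_def by simp
  qed
  have kernel: "residue_coeffs (G3 P n) p = \<zero>\<^bsub>UP (residue_algebra (G3 P n))\<^esub> \<longleftrightarrow> G4 P n dvd p" for p
    by (simp add: G4 const_poly_dvd_iff UP_def residue_coeffs_def zero_residue_algebra fun_eq_iff
        residue_eq_iff)
  obtain \<phi> where \<phi>: "\<phi> \<in> ring_iso (residue_algebra (G4 P n)) (UP (residue_algebra (G3 P n)))"
      "\<And>p. \<phi> (residue (G4 P n) p) = residue_coeffs (G3 P n) p"
    using residue_algebra_iso[OF residue_coeffs_hom range_residue_coeffs kernel] by blast
  have "residue_coeffs (G3 P n) (const4 a) = BT_const P n a" for a
    by (simp add: fun_eq_iff residue_coeffs_def const4_def BT_const_def BT_def UP_def B_const_def B_def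
        B_ideal_def carrier_residue_algebra zero_residue_algebra coeff_pCons split: nat.split)
  with \<phi> have "\<phi> \<in> alg_iso (BT4 P n) (BT4_const P n) (BT P n) (BT_const P n)"
    by (simp add: alg_iso_def BT4_as_residue_algebra BT4_const_def BT_def B_def B_ideal_def)
  then show ?thesis by (auto simp: alg_isomorphic_def)
qed

lemma BT_isomorphic_if_induces_iso:
  assumes "induces_iso P i j \<Phi>"
  shows "alg_isomorphic (BT P i) (BT_const P i) (BT P j) (BT_const P j)"
proof -
  have BT4_ring: "ring (BT4 P n)" for n
    unfolding BT4_as_residue_algebra by (rule cring.axioms(1)[OF cring_residue_algebra])
  have "alg_isomorphic (BT4 P i) (BT4_const P i) (BT4 P j) (BT4_const P j)"
    using assms by (auto simp: induces_iso_def alg_isomorphic_def)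
  moreover have "alg_isomorphic (BT P i) (BT_const P i) (BT4 P i) (BT4_const P i)"
    by (rule alg_isomorphic_sym[OF BT4_ring _ BT4_isomorphic_BT])
      (simp add: BT4_const_def BT4_as_residue_algebra carrier_residue_algebra)
  ultimately show ?thesis
    using BT4_isomorphic_BT by (blast intro: alg_isomorphic_trans)
qed

lemma BT_is_algebra: "ring (BT P n)" "BT_const P n a \<in> carrier (BT P n)"
proof -
  have B: "UP_ring (B P n)"
    unfolding B_def B_ideal_def by (rule UP_ring.intro[OF cring.axioms(1)[OF cring_residue_algebra]])
  show "ring (BT P n)" unfolding BT_def by (rule UP_ring.UP_ring[OF B])
  have "B_const P n a \<in> carrier (B P n)"
    unfolding B_const_def B_def B_ideal_def carrier_residue_algebra by simp
  then show "BT_const P n a \<in> carrier (BT P n)"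
    unfolding BT_const_def BT_def by (rule UP_ring.monom_closed[OF B])
qed

section \<open>Stable isomorphism of the Danielewski surfaces\<close>

theorem theorem5p6:
  fixes d :: nat and c :: "'k::field_char_0" and Q P :: "'k pol2"
  assumes "d \<ge> 2" and "c \<noteq> 0" and "P = P_poly d c Q"
  shows "(\<forall>n\<ge>1. \<forall>m\<ge>1.
             alg_isomorphic (BT P n) (BT_const P n) (BT P m) (BT_const P m))
       \<and> (\<forall>i\<ge>1. \<exists>!\<Phi>. is_Phi d c P i \<Phi>)
       \<and> (\<forall>n m. \<forall>\<Phi> :: nat \<Rightarrow> 'k pol4 \<Rightarrow> 'k pol4.
             1 \<le> n \<longrightarrow> n < m \<longrightarrow> (\<forall>i\<in>{n..<m}. is_Phi d c P i (\<Phi> i)) \<longrightarrow>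
             \<comment> \<open>\<open>fold\<close> applies \<open>\<Phi> n\<close> first and \<open>\<Phi> (m - 1)\<close> last\<close>
             induces_iso P n m (fold \<Phi> [n..<m]))"
proof (intro conjI allI impI)
  interpret Danielewski d c Q P using assms by unfold_locales
  show ex1: "\<exists>!\<Phi>. is_Phi d c P i \<Phi>" if "i \<ge> 1" for i
    using that by (rule ex1_Phi)
  show induces: "induces_iso P n m (fold \<Phi> [n..<m])"
    if "1 \<le> n" "n < m" "\<forall>i\<in>{n..<m}. is_Phi d c P i (\<Phi> i)" for n m \<Phi>
    using fold_Phi_bijective_mod[OF that(1) less_imp_le[OF that(2)] that(3)]
    by (intro induces_isoI) blast+
  have "\<forall>i. \<exists>\<Phi>. i \<ge> 1 \<longrightarrow> is_Phi d c P i \<Phi>" using ex1 by blast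
  then obtain \<Phi> where \<Phi>: "\<And>i. i \<ge> 1 \<Longrightarrow> is_Phi d c P i (\<Phi> i)" by metis
  have upward: "alg_isomorphic (BT P n) (BT_const P n) (BT P m) (BT_const P m)"
    if "1 \<le> n" "n < m" for n m
  proof (rule BT_isomorphic_if_induces_iso[OF induces[OF that]])
    show "\<forall>i\<in>{n..<m}. is_Phi d c P i (\<Phi> i)" using \<Phi> that(1) by simp
  qed
  show "alg_isomorphic (BT P n) (BT_const P n) (BT P m) (BT_const P m)"
    if "n \<ge> 1" "m \<ge> 1" for n m
  proof (cases n m rule: linorder_cases)
    case less
    then show ?thesis using \<open>n \<ge> 1\<close> by (intro upward)
  next
    case equal
    then show ?thesis by (simp add: alg_isomorphic_refl)
  next
    case greater
    then show ?thesis
      using alg_isomorphic_sym[OF BT_is_algebra upward] \<open>m \<ge> 1\<close> by blast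
  qed
qed

end
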